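(* Let $\tilde\theta_1,\tilde\theta_2\in\mathbb{R}^d$ and $\tilde\rho_1,\tilde\rho_2\in\mathbb{R}_+$ be the parameters of two training distributions $P_{\tilde\theta_1,\tilde\rho_1}$, $P_{\tilde\theta_2,\tilde\rho_2}$, and let $\theta_1,\theta_2\in\mathbb{R}^d$, $\rho_1,\rho_2\in\mathbb{R}_+$ be the parameters of two test distributions $P_{\theta_1,\rho_1}$, $P_{\theta_2,\rho_2}$. Consider three models: the two models trained separately on $\mathcal{D}_{n_1,\tilde\theta_1,\tilde\rho_1}$ and on $\mathcal{D}_{n_2,\tilde\theta_2,\tilde\rho_2}$, with slopes ${\rm Slope}_1$ and ${\rm Slope}_2$ respectively; and a model $\hat\theta_{n_1'+n_2'}$ trained on the combined (and possibly subsampled) dataset $\mathcal{D}_{n_1',\tilde\theta_1,\tilde\rho_1}\cup\mathcal{D}_{n_2',\tilde\theta_2,\tilde\rho_2}$. (The distributions, datasets, models and slopes are as defined in the context.) Then $${\rm Slope}_1\;\le\;{\rm Slope}\big(\hat\theta_{n_1'+n_2'}(\mathcal{D}_{n_1',\tilde\theta_1,\tilde\rho_1}\cup\mathcal{D}_{n_2',\tilde\theta_2,\tilde\rho_2})\big)\;\le\;{\rm Slope}_2 .$$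
   Context: Data distribution. For $\vartheta\in\mathbb{R}^d$ and $r\in\mathbb{R}_+$, $P_{\vartheta,r}$ is the joint distribution of $(x,y)\in\mathbb{R}^d\times\{\pm1\}$ with $y=\pm1$ uniformly at random and $x=y\vartheta+(\|\vartheta\|/r)w$, where $w$ is zero-mean with independent entries of variance one. $\mathcal{D}_{n,\vartheta,r}$ is a set of $n$ i.i.d. samples from $P_{\vartheta,r}$. Models trained on a single dataset. A model is a random vector $\hat\theta\in\mathbb{R}^d$ that predicts the label ${\rm sign}(\langle x,\hat\theta\rangle)$ for a test example $x$. For $j\in\{1,2\}$, the model trained on $\mathcal{D}_{n_j,\tilde\theta_j,\tilde\rho_j}$ is $\hat\theta_{n_j,\xi_j}(\mathcal{D}_{n_j,\tilde\theta_j,\tilde\rho_j})=\tilde\theta_j+\frac{\xi_j\|\tilde\theta_j\|}{\tilde\rho_j\sqrt{n_j}}z$, where $z\in\mathbb{R}^d$ is zero-mean with independent entries of variance one and $\xi_j\in\mathbb{R}_+$ captures the variation due to the training algorithm. Model trained on the combined dataset. The model is the random vector $$\hat\theta_{n_1'+n_2',\xi}(\mathcal{D}_{n_1',\tilde\theta_1,\tilde\rho_1}\cup\mathcal{D}_{n_2',\tilde\theta_2,\tilde\rho_2})=\bar\theta+\frac{\xi\|\bar\theta\|}{\bar\rho\sqrt{n_1'+n_2'}}\,z,\qquad \bar\theta=\frac{n_1'\tilde\theta_1+n_2'\tilde\theta_2}{n_1'+n_2'},$$ $$\bar\rho=\|\bar\theta\|\Big/\sqrt{\tfrac{1}{n_1'+n_2'}\big(n_1'\|\tilde\theta_1\|^2/\tilde\rho_1^2+n_2'\|\tilde\theta_2\|^2/\tilde\rho_2^2\big)},$$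 with $z\in\mathbb{R}^d$ zero-mean with independent entries of variance one and $\xi\in\mathbb{R}_+$. The subscript $\xi$ is omitted in the claim because the slope does not depend on it. Slope. With $\cos(u,v)=\langle u,v\rangle/(\|u\|\|v\|)$, the slope of a trained model is determined by the mean parameter of the model: $${\rm Slope}_j={\rm Slope}\big(\hat\theta_{n_j}(\mathcal{D}_{n_j,\tilde\theta_j,\tilde\rho_j})\big)=\frac{\cos(\theta_2,\tilde\theta_j)\,\rho_2}{\cos(\theta_1,\tilde\theta_j)\,\rho_1}\quad(j=1,2),$$ $${\rm Slope}\big(\hat\theta_{n_1'+n_2'}(\mathcal{D}_{n_1',\tilde\theta_1,\tilde\rho_1}\cup\mathcal{D}_{n_2',\tilde\theta_2,\tilde\rho_2})\big)=\frac{\cos(\theta_2,\bar\theta)\,\rho_2}{\cos(\theta_1,\bar\theta)\,\rho_1}.$$ (It is the slope of the asymptotic linear relation between the probit-transformed accuracies of the model on the two test distributions, with $P_{\theta_1,\rho_1}$ on the horizontal axis and $P_{\theta_2,\rho_2}$ on the vertical axis.)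
   Formalization: The claim is proved assuming Slope_1 ≤ Slope_2 (a choice of labelling) and that cos(θ_1,θ̃_1) and cos(θ_1,θ̃_2) are nonzero with the same sign; without these the printed chain fails or a slope is undefined. *)

theory Defs
  imports "HOL-Probability.Probability"
begin

text \<open>Random vectors with independent, zero-mean, unit-variance entries.\<close>

definition standardized :: "'a measure \<Rightarrow> ('a \<Rightarrow> real ^ 'd::finite) \<Rightarrow> bool" where
  "standardized M z \<longleftrightarrow>
     prob_space M \<and>
     prob_space.indep_vars M (\<lambda>_. borel) (\<lambda>i \<omega>. z \<omega> $ i) UNIV \<and>
     (\<forall>i. integrable M (\<lambda>\<omega>. (z \<omega> $ i)\<^sup>2) \<and>
          prob_space.expectation M (\<lambda>\<omega>. z \<omega> $ i) = 0 \<and>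
          prob_space.variance M (\<lambda>\<omega>. z \<omega> $ i) = 1)"

text \<open>
  The parameters do not fix the law of the noise \<open>w\<close>, so this is a predicate: \<open>P\<close> is a
  distribution with parameters \<open>\<theta>\<close> and \<open>r\<close> for some admissible noise law \<open>W\<close>.  The product
  measure makes the label \<open>y\<close> and the noise independent.
\<close>

definition data_distribution ::
    "real ^ 'd::finite \<Rightarrow> real \<Rightarrow> ((real ^ 'd) \<times> real) measure \<Rightarrow> bool" where
  "data_distribution \<theta> r P \<longleftrightarrow>
     (\<exists>W. sets W = sets borel \<and> standardized W (\<lambda>w. w) \<and>
          P = distr (measure_pmf (pmf_of_set {-1, 1}) \<Otimes>\<^sub>M W) borel
                (\<lambda>(y, w). (y *\<^sub>R \<theta> + (norm \<theta> / r) *\<^sub>R w, y)))"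

definition iid_samples ::
    "'a measure \<Rightarrow> ((real ^ 'd::finite) \<times> real) measure \<Rightarrow> nat \<Rightarrow>
     (nat \<Rightarrow> 'a \<Rightarrow> (real ^ 'd) \<times> real) \<Rightarrow> bool" where
  "iid_samples M P n D \<longleftrightarrow>
     prob_space M \<and> prob_space.indep_vars M (\<lambda>_. borel) D {..<n} \<and>
     (\<forall>i<n. distr M borel (D i) = P)"

text \<open>
  The random vector \<open>h\<close> has mean parameter \<open>\<theta>\<close> and fluctuates like an average of \<open>n\<close> samples
  from a distribution with parameters \<open>\<theta>\<close> and \<open>r\<close>, up to the training-algorithm factor \<open>\<xi>\<close>.
\<close>

definition model_form ::
    "'a measure \<Rightarrow> real ^ 'd::finite \<Rightarrow> real \<Rightarrow> nat \<Rightarrow> real \<Rightarrow> ('a \<Rightarrow> real ^ 'd) \<Rightarrow> bool" where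
  "model_form M \<theta> r n \<xi> h \<longleftrightarrow>
     (\<exists>z. standardized M z \<and>
          h = (\<lambda>\<omega>. \<theta> + (\<xi> * norm \<theta> / (r * sqrt (real n))) *\<^sub>R z \<omega>))"

text \<open>
  A trained model is tied to its dataset only through the size and the parameters of the
  dataset; no further coupling between the samples and the model noise is imposed.
\<close>

definition trained_single ::
    "'a measure \<Rightarrow> ((real ^ 'd::finite) \<times> real) measure \<Rightarrow> real ^ 'd \<Rightarrow> real \<Rightarrow> nat \<Rightarrow>
     (nat \<Rightarrow> 'a \<Rightarrow> (real ^ 'd) \<times> real) \<Rightarrow> real \<Rightarrow> ('a \<Rightarrow> real ^ 'd) \<Rightarrow> bool" where
  "trained_single M P \<theta> r n D \<xi> h \<longleftrightarrow>
     data_distribution \<theta> r P \<and> iid_samples M P n D \<and> model_form M \<theta> r n \<xi> h"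

definition combined_mean ::
    "nat \<Rightarrow> real ^ 'd::finite \<Rightarrow> nat \<Rightarrow> real ^ 'd \<Rightarrow> real ^ 'd" where
  "combined_mean n1 \<tau>1 n2 \<tau>2 =
     (1 / real (n1 + n2)) *\<^sub>R (real n1 *\<^sub>R \<tau>1 + real n2 *\<^sub>R \<tau>2)"

definition combined_ratio ::
    "nat \<Rightarrow> real ^ 'd::finite \<Rightarrow> real \<Rightarrow> nat \<Rightarrow> real ^ 'd \<Rightarrow> real \<Rightarrow> real" where
  "combined_ratio n1 \<tau>1 r1 n2 \<tau>2 r2 =
     norm (combined_mean n1 \<tau>1 n2 \<tau>2) /
     sqrt (1 / real (n1 + n2) *
           (real n1 * (norm \<tau>1)\<^sup>2 / r1\<^sup>2 + real n2 * (norm \<tau>2)\<^sup>2 / r2\<^sup>2))"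

text \<open>The combined dataset is the union of the samples \<open>D1\<close> and the samples \<open>D2\<close>.\<close>

definition trained_combined ::
    "'a measure \<Rightarrow>
     ((real ^ 'd::finite) \<times> real) measure \<Rightarrow> real ^ 'd \<Rightarrow> real \<Rightarrow> nat \<Rightarrow>
     (nat \<Rightarrow> 'a \<Rightarrow> (real ^ 'd) \<times> real) \<Rightarrow>
     ((real ^ 'd) \<times> real) measure \<Rightarrow> real ^ 'd \<Rightarrow> real \<Rightarrow> nat \<Rightarrow>
     (nat \<Rightarrow> 'a \<Rightarrow> (real ^ 'd) \<times> real) \<Rightarrow>
     real \<Rightarrow> ('a \<Rightarrow> real ^ 'd) \<Rightarrow> bool" where
  "trained_combined M P1 \<tau>1 r1 n1 D1 P2 \<tau>2 r2 n2 D2 \<xi> h \<longleftrightarrow>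
     data_distribution \<tau>1 r1 P1 \<and> iid_samples M P1 n1 D1 \<and>
     data_distribution \<tau>2 r2 P2 \<and> iid_samples M P2 n2 D2 \<and>
     model_form M (combined_mean n1 \<tau>1 n2 \<tau>2) (combined_ratio n1 \<tau>1 r1 n2 \<tau>2 r2)
       (n1 + n2) \<xi> h"

definition vcos :: "'v::real_inner \<Rightarrow> 'v \<Rightarrow> real" where
  "vcos u v = (u \<bullet> v) / (norm u * norm v)"

text \<open>
  The slope is a function of the mean of the model \<open>h\<close>; for the models above the noise is
  centred, so the mean is \<open>\<theta>\<close> and \<open>combined_mean n1 \<tau>1 n2 \<tau>2\<close>, respectively.  The test
  distribution with parameters \<open>\<theta>1\<close>, \<open>\<rho>1\<close> is on the horizontal axis.
\<close>

definition slope ::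
    "real ^ 'd::finite \<Rightarrow> real \<Rightarrow> real ^ 'd \<Rightarrow> real \<Rightarrow> 'a measure \<Rightarrow> ('a \<Rightarrow> real ^ 'd) \<Rightarrow> real"
where
  "slope \<theta>1 \<rho>1 \<theta>2 \<rho>2 M h =
     (let m = (\<integral>\<omega>. h \<omega> \<partial>M)
      in (vcos \<theta>2 m * \<rho>2) / (vcos \<theta>1 m * \<rho>1))"

end

theory Submission
  imports Defs
begin

text \<open>
  The noise is centred, so the mean of a model is its mean parameter \<open>m\<close>.  The norm of \<open>m\<close>
  cancels in the quotient of cosines, which makes the slope a fixed nonnegative multiple of
  \<open>(\<theta>2 \<bullet> m) / (\<theta>1 \<bullet> m)\<close>.  As numerator and denominator are linear in \<open>m\<close>, the slope at a
  weighted mean of \<open>\<tau>1\<close> and \<open>\<tau>2\<close> is a mediant of the slopes at \<open>\<tau>1\<close> and \<open>\<tau>2\<close>, provided that the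
  two denominators have the same sign.
\<close>

lemma standardized_has_bochner_integral:
  fixes z :: "'a \<Rightarrow> real ^ 'd::finite"
  assumes "standardized M z"
  shows "has_bochner_integral M z 0"
proof -
  interpret prob_space M
    using assms by (simp add: standardized_def)
  have "has_bochner_integral M (\<lambda>\<omega>. z \<omega> $ i) 0" for i
  proof -
    have "random_variable borel (\<lambda>\<omega>. z \<omega> $ i)"
      using assms by (auto simp: standardized_def indep_vars_def)
    \<comment> \<open>Expectation 0 alone would not give integrability, since a nonintegrable
      function has integral 0 by default. On a probability space the integrable square supplies
      it.\<close>
    moreover have "integrable M (\<lambda>\<omega>. (z \<omega> $ i)\<^sup>2)" "expectation (\<lambda>\<omega>. z \<omega> $ i) = 0"
      using assms by (auto simp: standardized_def)
    ultimately show ?thesis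
      by (metis square_integrable_imp_integrable has_bochner_integral_integrable)
  qed
  \<comment> \<open>The coordinates are reassembled along the standard basis to pass from entries to
    the vector.\<close>
  then have "has_bochner_integral M (\<lambda>\<omega>. \<Sum>i\<in>UNIV. (z \<omega> $ i) *\<^sub>R axis i (1::real))
      (\<Sum>i\<in>(UNIV::'d set). 0 *\<^sub>R axis i 1)"
    by (intro has_bochner_integral_sum has_bochner_integral_scaleR_left)
  then show ?thesis
    using basis_expansion[of "z _"] by (simp add: scalar_mult_eq_scaleR)
qed

lemma model_form_mean:
  assumes "model_form M \<theta> r n \<xi> h"
  shows "(\<integral>\<omega>. h \<omega> \<partial>M) = \<theta>"
proof -
  obtain z where z: "standardized M z"
    and h: "h = (\<lambda>\<omega>. \<theta> + (\<xi> * norm \<theta> / (r * sqrt (real n))) *\<^sub>R z \<omega>)"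
    using assms by (auto simp: model_form_def)
  interpret prob_space M
    using z by (simp add: standardized_def)
  show ?thesis
    using standardized_has_bochner_integral[OF z]
    by (simp add: h has_bochner_integral_iff prob_space)
qed

text \<open>A cosine with a zero vector is 0 by division by zero, so a positive product forces all
  three vectors to be nonzero; the cosines then differ from the inner products by positive
  factors.\<close>

lemma vcos_pos_mult_imp_inner_pos_mult:
  assumes "vcos u v * vcos u w > 0"
  shows "(u \<bullet> v) * (u \<bullet> w) > 0"
proof -
  have "(u \<bullet> v) * (u \<bullet> w) = vcos u v * vcos u w * ((norm u)\<^sup>2 * norm v * norm w)"
    by (auto simp: vcos_def power2_eq_square)
  moreover have "u \<noteq> 0" "v \<noteq> 0" "w \<noteq> 0"
    using assms by (auto simp: vcos_def)
  ultimately show ?thesis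
    using assms by simp
qed

lemma slope_eq:
  assumes "model_form M m r n \<xi> h" "\<theta>1 \<bullet> m \<noteq> 0"
  shows "slope \<theta>1 \<rho>1 \<theta>2 \<rho>2 M h
       = (norm \<theta>1 * \<rho>2 / (norm \<theta>2 * \<rho>1)) * ((\<theta>2 \<bullet> m) / (\<theta>1 \<bullet> m))"
  using assms(2) by (auto simp: slope_def model_form_mean[OF assms(1)] vcos_def field_simps)

lemma mediant_pos:
  fixes a1 a2 b1 b2 p q :: real
  assumes "a1 > 0" "a2 > 0" "p \<ge> 0" "q \<ge> 0" "p + q > 0" "b1 / a1 \<le> b2 / a2"
  shows "p * a1 + q * a2 > 0"
    and "b1 / a1 \<le> (p * b1 + q * b2) / (p * a1 + q * a2)"
    and "(p * b1 + q * b2) / (p * a1 + q * a2) \<le> b2 / a2"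
proof -
  show pos: "p * a1 + q * a2 > 0"
    using assms by (cases "p = 0") (auto intro: add_pos_nonneg)
  have "b1 * a2 \<le> b2 * a1"
    using assms by (simp add: field_simps)
  \<comment> \<open>Clearing denominators in the lower bound cancels the \<open>p\<close> terms and
    leaves the inequality scaled by \<open>q\<close>; in the upper bound the \<open>q\<close> terms
    cancel and \<open>p\<close> remains.\<close>
  then have p: "p * (b1 * a2) \<le> p * (b2 * a1)" and q: "q * (b1 * a2) \<le> q * (b2 * a1)"
    using assms by (auto intro: mult_left_mono)
  show "b1 / a1 \<le> (p * b1 + q * b2) / (p * a1 + q * a2)"
    using q pos assms(1) by (simp add: pos_divide_le_eq pos_le_divide_eq algebra_simps)
  show "(p * b1 + q * b2) / (p * a1 + q * a2) \<le> b2 / a2"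
    using p pos assms(2) by (simp add: pos_divide_le_eq pos_le_divide_eq algebra_simps)
qed

lemma mediant:
  fixes a1 a2 b1 b2 p q :: real
  assumes "a1 * a2 > 0" "p \<ge> 0" "q \<ge> 0" "p + q > 0" "b1 / a1 \<le> b2 / a2"
  shows "p * a1 + q * a2 \<noteq> 0"
    and "b1 / a1 \<le> (p * b1 + q * b2) / (p * a1 + q * a2)"
    and "(p * b1 + q * b2) / (p * a1 + q * a2) \<le> b2 / a2"
proof -
  consider "a1 > 0" "a2 > 0" | "a1 < 0" "a2 < 0"
    using assms(1) by (auto simp: zero_less_mult_iff)
  then have "p * a1 + q * a2 \<noteq> 0 \<and> b1 / a1 \<le> (p * b1 + q * b2) / (p * a1 + q * a2)
      \<and> (p * b1 + q * b2) / (p * a1 + q * a2) \<le> b2 / a2"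
  proof cases
    case 1
    then show ?thesis
      using mediant_pos[of a1 a2 p q b1 b2] assms by auto
  next
    case 2
    \<comment> \<open>Changing the sign of all numerators and denominators preserves every fraction,
      which reduces this case to \<open>mediant_pos\<close>.\<close>
    have "(p * - b1 + q * - b2) / (p * - a1 + q * - a2) = (p * b1 + q * b2) / (p * a1 + q * a2)"
      using minus_divide_divide[of "p * b1 + q * b2" "p * a1 + q * a2"] by simp
    with 2 show ?thesis
      using mediant_pos[of "- a1" "- a2" p q "- b1" "- b2"] assms by auto
  qed
  then show "p * a1 + q * a2 \<noteq> 0"
    and "b1 / a1 \<le> (p * b1 + q * b2) / (p * a1 + q * a2)"
    and "(p * b1 + q * b2) / (p * a1 + q * a2) \<le> b2 / a2"
    by auto
qed

theorem theorem2:
  fixes \<theta>1 \<theta>2 \<tau>1 \<tau>2 :: "real ^ 'd::finite"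
    and \<rho>1 \<rho>2 r1 r2 \<xi>1 \<xi>2 \<xi> :: real
    and n1 n2 n1' n2' :: nat
    and P1 P2 Q1 Q2 :: "((real ^ 'd) \<times> real) measure"
    and M1 :: "'a measure" and M2 :: "'b measure" and M :: "'c measure"
    and D1 :: "nat \<Rightarrow> 'a \<Rightarrow> (real ^ 'd) \<times> real"
    and D2 :: "nat \<Rightarrow> 'b \<Rightarrow> (real ^ 'd) \<times> real"
    and D1' D2' :: "nat \<Rightarrow> 'c \<Rightarrow> (real ^ 'd) \<times> real"
    and h1 :: "'a \<Rightarrow> real ^ 'd" and h2 :: "'b \<Rightarrow> real ^ 'd" and h :: "'c \<Rightarrow> real ^ 'd"
  assumes "r1 > 0" "r2 > 0" "\<rho>1 > 0" "\<rho>2 > 0"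
    and "\<xi>1 \<ge> 0" "\<xi>2 \<ge> 0" "\<xi> \<ge> 0"
    and "n1 > 0" "n2 > 0" "n1' \<le> n1" "n2' \<le> n2" "n1' + n2' > 0"
    and "data_distribution \<theta>1 \<rho>1 Q1" "data_distribution \<theta>2 \<rho>2 Q2"
    and "trained_single M1 P1 \<tau>1 r1 n1 D1 \<xi>1 h1"
    and "trained_single M2 P2 \<tau>2 r2 n2 D2 \<xi>2 h2"
    and "trained_combined M P1 \<tau>1 r1 n1' D1' P2 \<tau>2 r2 n2' D2' \<xi> h"
    and same_side: "vcos \<theta>1 \<tau>1 * vcos \<theta>1 \<tau>2 > 0"
    and ordered: "slope \<theta>1 \<rho>1 \<theta>2 \<rho>2 M1 h1 \<le> slope \<theta>1 \<rho>1 \<theta>2 \<rho>2 M2 h2"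
  shows "slope \<theta>1 \<rho>1 \<theta>2 \<rho>2 M1 h1 \<le> slope \<theta>1 \<rho>1 \<theta>2 \<rho>2 M h
       \<and> slope \<theta>1 \<rho>1 \<theta>2 \<rho>2 M h \<le> slope \<theta>1 \<rho>1 \<theta>2 \<rho>2 M2 h2"
proof -
  define m where "m = combined_mean n1' \<tau>1 n2' \<tau>2"
  define c where "c = norm \<theta>1 * \<rho>2 / (norm \<theta>2 * \<rho>1)"
  define p q where "p = real n1' / real (n1' + n2')" and "q = real n2' / real (n1' + n2')"
  have pq: "p \<ge> 0" "q \<ge> 0" "p + q > 0"
    using assms(12) by (auto simp: p_def q_def simp flip: add_divide_distrib)
  have m_inner: "u \<bullet> m = p * (u \<bullet> \<tau>1) + q * (u \<bullet> \<tau>2)" for u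
    by (simp add: m_def combined_mean_def p_def q_def inner_simps add_divide_distrib)
  have f1: "model_form M1 \<tau>1 r1 n1 \<xi>1 h1" and f2: "model_form M2 \<tau>2 r2 n2 \<xi>2 h2"
    using assms by (auto simp: trained_single_def)
  have f: "model_form M m (combined_ratio n1' \<tau>1 r1 n2' \<tau>2 r2) (n1' + n2') \<xi> h"
    using assms by (auto simp: trained_combined_def m_def)
  have same: "(\<theta>1 \<bullet> \<tau>1) * (\<theta>1 \<bullet> \<tau>2) > 0"
    using same_side by (rule vcos_pos_mult_imp_inner_pos_mult)
  then have nz: "\<theta>1 \<bullet> \<tau>1 \<noteq> 0" "\<theta>1 \<bullet> \<tau>2 \<noteq> 0" "\<theta>1 \<noteq> 0"
    by auto
  note s1 = slope_eq[OF f1 nz(1), of \<rho>1 \<theta>2 \<rho>2, folded c_def]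
  note s2 = slope_eq[OF f2 nz(2), of \<rho>1 \<theta>2 \<rho>2, folded c_def]
  show ?thesis
  proof (cases "\<theta>2 = 0")
    \<comment> \<open>All three slopes are 0 here. The case is split off because \<open>c\<close>
      has \<open>norm \<theta>2\<close> in its denominator, so it is 0 and cannot be cancelled from
      \<open>ordered\<close>.\<close>
    case True
    then show ?thesis
      by (simp add: slope_def vcos_def)
  next
    case False
    then have c: "c > 0"
      using assms(3,4) nz(3) by (simp add: c_def)
    have "(\<theta>2 \<bullet> \<tau>1) / (\<theta>1 \<bullet> \<tau>1) \<le> (\<theta>2 \<bullet> \<tau>2) / (\<theta>1 \<bullet> \<tau>2)"
      using ordered c unfolding s1 s2 by (rule mult_left_le_imp_le)
    \<comment> \<open>Folding turns the weighted sums into inner products with \<open>m\<close>. The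
      first part, \<open>\<theta>1 \<bullet> m \<noteq> 0\<close>, is what \<open>slope_eq\<close>
      requires at the combined mean.\<close>
    note med = mediant[OF same pq this, folded m_inner]
    show ?thesis
      unfolding s1 s2 slope_eq[OF f med(1), of \<rho>1 \<theta>2 \<rho>2, folded c_def]
      using c med(2,3) by (intro conjI mult_left_mono) auto
  qed
qed

end
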